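(* Let $G$ be a finitely generated nilpotent group such that $G/G'$ is torsion-free, where $G'=[G,G]$ is the commutator subgroup of $G$. Then $\mathrm{rk}_S(G) = \mathrm{rk}_G(G) + 1$.
   Context: For a subset $X$ of a group $G$, $X^+$ denotes the subsemigroup of $G$ generated by $X$ (all products of one or more elements of $X$; $\emptyset^+=\emptyset$) and $\langle X\rangle$ the subgroup generated by $X$. For a finitely generated group $G$, the semigroup rank is $\mathrm{rk}_S(G)=\min\{|X| : X\subseteq G,\ X^+=G\}$ and the group rank is $\mathrm{rk}_G(G)=\min\{|X| : X\subseteq G,\ \langle X\rangle=G\}$. A group is torsion-free if its only element of finite order is the identity. *)

theory Defs
  imports "HOL-Algebra.Generated_Groups"
begin

inductive_set semigroup_generate :: "('a, 'b) monoid_scheme \<Rightarrow> 'a set \<Rightarrow> 'a set"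
  for G and X where
    incl: "x \<in> X \<Longrightarrow> x \<in> semigroup_generate G X"
  | mult: "x \<in> semigroup_generate G X \<Longrightarrow> y \<in> semigroup_generate G X
            \<Longrightarrow> x \<otimes>\<^bsub>G\<^esub> y \<in> semigroup_generate G X"

definition finitely_generated_group :: "('a, 'b) monoid_scheme \<Rightarrow> bool" where
  "finitely_generated_group G \<longleftrightarrow>
     group G \<and> (\<exists>X. finite X \<and> X \<subseteq> carrier G \<and> generate G X = carrier G)"

text \<open>
  In both ranks, \<open>finite X\<close> is needed because \<open>card\<close> is \<open>0\<close> on infinite sets. For a
  finitely generated group both minima range over nonempty sets (if \<open>X\<close> is a finite
  generating set, then \<open>X\<close>, the inverses of its elements, and \<open>\<one>\<close> together generate the
  group as a semigroup); for other groups the two values are unspecified.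
\<close>

definition semigroup_rank :: "('a, 'b) monoid_scheme \<Rightarrow> nat" where
  "semigroup_rank G =
     (LEAST n. \<exists>X. finite X \<and> X \<subseteq> carrier G \<and> semigroup_generate G X = carrier G \<and> card X = n)"

definition group_rank :: "('a, 'b) monoid_scheme \<Rightarrow> nat" where
  "group_rank G =
     (LEAST n. \<exists>X. finite X \<and> X \<subseteq> carrier G \<and> generate G X = carrier G \<and> card X = n)"

definition torsion_free_group :: "('a, 'b) monoid_scheme \<Rightarrow> bool" where
  "torsion_free_group G \<longleftrightarrow>
     group G \<and> (\<forall>x\<in>carrier G. (\<exists>n::nat. n > 0 \<and> x [^]\<^bsub>G\<^esub> n = \<one>\<^bsub>G\<^esub>) \<longrightarrow> x = \<one>\<^bsub>G\<^esub>)"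

text \<open>
  The index is shifted: \<open>lower_central G n\<close> is the term usually written
  \<open>\<gamma>\<^sub>n\<^sub>+\<^sub>1(G)\<close>. The commutator convention is that of \<open>derived\<close>.
\<close>

primrec lower_central :: "('a, 'b) monoid_scheme \<Rightarrow> nat \<Rightarrow> 'a set" where
  "lower_central G 0 = carrier G"
| "lower_central G (Suc n) =
     generate G (\<Union>h\<in>lower_central G n. \<Union>g\<in>carrier G.
       {h \<otimes>\<^bsub>G\<^esub> g \<otimes>\<^bsub>G\<^esub> inv\<^bsub>G\<^esub> h \<otimes>\<^bsub>G\<^esub> inv\<^bsub>G\<^esub> g})"

definition nilpotent_group :: "('a, 'b) monoid_scheme \<Rightarrow> bool" where
  "nilpotent_group G \<longleftrightarrow> group G \<and> (\<exists>n. lower_central G n = {\<one>\<^bsub>G\<^esub>})"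

end

theory Submission
  imports Defs "HOL-Algebra.FiniteProduct"
begin

text \<open>
  Upper bound, valid in every group: if \<open>X\<close> generates \<open>G\<close> as a group, one further element \<open>y\<close>
  (the inverse of the product of \<open>X\<close>) suffices to write all inverses as positive words.
  Lower bound: if \<open>X\<close> generates \<open>G\<close> as a semigroup, then \<open>\<one>\<close> is a positive word in \<open>X\<close>, which
  becomes a nontrivial relation with exponents in \<open>\<nat>\<close> in \<open>G/G'\<close>. Euclid's algorithm on
  the exponents turns this into \<open>z\<^sup>k = \<one>\<close> for a member \<open>z\<close> of another generating family of
  the same size; since \<open>G/G'\<close> is torsion-free, \<open>z\<close> can be dropped. So \<open>G/G'\<close> is generated by fewer
  than \<open>|X|\<close> elements, and lifts of generators of \<open>G/G'\<close> generate \<open>G\<close> because \<open>G\<close> is nilpotent.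
\<close>

section \<open>Semigroup generation\<close>

lemma semigroup_generate_least:
  assumes "X \<subseteq> semigroup_generate G Y"
  shows "semigroup_generate G X \<subseteq> semigroup_generate G Y"
proof
  fix x assume "x \<in> semigroup_generate G X"
  then show "x \<in> semigroup_generate G Y"
    by induction (use assms in \<open>auto intro: semigroup_generate.mult\<close>)
qed

lemma (in group) semigroup_generate_subset_generate:
  "semigroup_generate G X \<subseteq> generate G X"
proof
  fix x assume "x \<in> semigroup_generate G X"
  then show "x \<in> generate G X"
    by induction (auto intro: generate.intros)
qed

text \<open>\<open>generate\<close> closes off under products and inverts only the generators
  themselves, so inverses of generators are all that positive words must supply. Nonemptiness gives
  \<one> as \<open>x \<otimes> inv x\<close>; the empty set generates the empty semigroup.\<close>

lemma (in group) generate_subset_semigroup_generate: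
  assumes "X \<subseteq> carrier G" "X \<noteq> {}" "\<And>x. x \<in> X \<Longrightarrow> inv x \<in> semigroup_generate G X"
  shows "generate G X \<subseteq> semigroup_generate G X"
proof
  fix x assume "x \<in> generate G X"
  then show "x \<in> semigroup_generate G X"
  proof induction
    case one
    obtain x where x: "x \<in> X" using assms(2) by blast
    have "x \<otimes> inv x \<in> semigroup_generate G X"
      using semigroup_generate.mult[OF semigroup_generate.incl[OF x] assms(3)[OF x]] .
    then show ?case using x assms(1) by (simp add: subset_iff)
  qed (use assms(3) in \<open>auto intro: semigroup_generate.intros\<close>)
qed

text \<open>Passing from \<open>X\<close> to \<open>insert x X\<close> replaces \<open>y\<close> by
  \<open>y \<otimes> inv x\<close>. Multiplying by \<open>x\<close> on the right recovers the old
  \<open>y\<close>, so the induction hypothesis still supplies its inverse and those of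
  \<open>X\<close>; the two remaining inverses are
  \<open>inv y \<otimes> (y \<otimes> inv x)\<close> and \<open>x \<otimes> inv y\<close>.\<close>

lemma (in group) ex_generate_subset_semigroup_generate_insert:
  assumes "finite X" "X \<subseteq> carrier G"
  shows "\<exists>y\<in>carrier G. generate G (insert y X) \<subseteq> semigroup_generate G (insert y X)"
  using assms
proof induction
  case empty
  \<comment> \<open>The empty product: here \<open>y\<close> is \<one>.\<close>
  have "generate G {\<one>} \<subseteq> semigroup_generate G {\<one>}"
    by (auto simp: generate_one intro: semigroup_generate.incl)
  then show ?case by blast
next
  case (insert x X)
  then obtain y where y: "y \<in> carrier G"
    and sub: "generate G (insert y X) \<subseteq> semigroup_generate G (insert y X)" by auto
  have xc: "x \<in> carrier G" and Xc: "X \<subseteq> carrier G" using insert.prems by auto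
  define Y where "Y = insert (y \<otimes> inv x) (insert x X)"
  have Yc: "Y \<subseteq> carrier G" using y xc Xc by (auto simp: Y_def)
  have gens: "y \<otimes> inv x \<in> semigroup_generate G Y" "x \<in> semigroup_generate G Y"
    "X \<subseteq> semigroup_generate G Y"
    by (auto simp: Y_def intro: semigroup_generate.incl)
  have "y \<in> semigroup_generate G Y"
    using semigroup_generate.mult[OF gens(1,2)] y xc by (simp add: m_assoc)
  then have "semigroup_generate G (insert y X) \<subseteq> semigroup_generate G Y"
    using gens(3) by (intro semigroup_generate_least) auto
  then have old: "generate G (insert y X) \<subseteq> semigroup_generate G Y" using sub by blast
  have iy: "inv y \<in> semigroup_generate G Y"
    using old generate.inv[of y "insert y X" G] by blast
  have ix: "inv x \<in> semigroup_generate G Y"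
    using semigroup_generate.mult[OF iy gens(1)] y xc by (simp add: m_assoc[symmetric])
  have "inv z \<in> semigroup_generate G Y" if zY: "z \<in> Y" for z
  proof -
    consider "z = y \<otimes> inv x" | "z = x" | "z \<in> X" using zY unfolding Y_def by blast
    then show ?thesis
    proof cases
      case 1
      then show ?thesis
        using semigroup_generate.mult[OF gens(2) iy] y xc by (simp add: inv_mult_group)
    next
      case 2
      then show ?thesis using ix by simp
    next
      case 3
      then show ?thesis using old generate.inv[of z "insert y X" G] by blast
    qed
  qed
  then have "generate G Y \<subseteq> semigroup_generate G Y"
    using Yc by (intro generate_subset_semigroup_generate) (auto simp: Y_def)
  then show ?case using y xc unfolding Y_def by (intro bexI[of _ "y \<otimes> inv x"]) auto
qed

section \<open>Generators and relations in abelian groups\<close>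

text \<open>Generators form an indexed family because a Euclid step may make two members coincide,
  while \<open>card I\<close> stays fixed. The induction is on the sum of the exponents.\<close>

lemma (in comm_group) generate_drop_of_relation:
  fixes x :: "'i \<Rightarrow> 'a" and k :: "'i \<Rightarrow> nat"
  assumes "torsion_free_group G" "finite I" "x \<in> I \<rightarrow> carrier G"
    and "generate G (x ` I) = carrier G"
    and "finprod G (\<lambda>i. x i [^] k i) I = \<one>" "\<exists>i\<in>I. k i > 0"
  shows "\<exists>Y. finite Y \<and> Y \<subseteq> carrier G \<and> generate G Y = carrier G \<and> card Y < card I"
  using assms(3-6)
proof (induction "sum k I" arbitrary: k x rule: less_induct)
  case less
  note xI = less.prems(1)
  obtain j where j: "j \<in> I" "k j > 0" using less.prems(4) by blast
  show ?case
  proof (cases "\<exists>i\<in>I. i \<noteq> j \<and> k i > 0")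
    case False
    \<comment> \<open>Only \<open>j\<close> has a positive exponent, so the relation is a power of
      \<open>x j\<close> equal to \<one>; torsion-freeness makes \<open>x j\<close> trivial and
      hence redundant.\<close>
    have Ij: "I = insert j (I - {j})" using j(1) by auto
    have "finprod G (\<lambda>i. x i [^] k i) (I - {j}) = \<one>"
      by (intro finprod_one_eqI) (use False in auto)
    moreover have "finprod G (\<lambda>i. x i [^] k i) I
        = x j [^] k j \<otimes> finprod G (\<lambda>i. x i [^] k i) (I - {j})"
      using xI j(1) assms(2) by (subst Ij, subst finprod_insert) (auto simp: Pi_iff)
    ultimately have "x j [^] k j = \<one>"
      using less.prems(3) xI j(1) by (auto simp: Pi_iff)
    then have xj: "x j = \<one>"
      using assms(1) j xI unfolding torsion_free_group_def by (auto simp: Pi_iff)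
    have sub: "x ` (I - {j}) \<subseteq> carrier G" using xI by (auto simp: Pi_iff)
    have "x t \<in> generate G (x ` (I - {j}))" if "t \<in> I" for t
      using that xj by (cases "t = j") (auto intro: generate.incl generate.one)
    then have "x ` I \<subseteq> generate G (x ` (I - {j}))" by blast
    then have "generate G (x ` I) \<subseteq> generate G (x ` (I - {j}))"
      using generate_is_subgroup[OF sub] by (rule generate_subgroup_incl)
    then have "generate G (x ` (I - {j})) = carrier G"
      using less.prems(2) generate_incl[OF sub] by auto
    moreover have "card (x ` (I - {j})) < card I"
      using card_image_le[of "I - {j}" x] card_Diff1_less[OF assms(2) j(1)] assms(2)
      by auto
    ultimately show ?thesis using sub assms(2) by blast
  next
    case True
    then obtain i' where "i' \<in> I" "i' \<noteq> j" "k i' > 0" by blast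
    \<comment> \<open>With \<open>l\<close> carrying the smaller exponent, the subtraction
      \<open>k i - k l\<close> on naturals is exact. Positivity of \<open>k l\<close> makes the sum
      drop and leaves a positive exponent at \<open>l\<close>.\<close>
    then obtain i l where il: "i \<in> I" "l \<in> I" "i \<noteq> l" "k l > 0" "k l \<le> k i"
      using j by (metis nat_le_linear)
    \<comment> \<open>\<open>a\<^sup>m b\<^sup>n = a\<^bsup>m-n\<^esup> (ab)\<^sup>n\<close> for \<open>n \<le> m\<close>\<close>
    define x' where "x' = x(l := x i \<otimes> x l)"
    define k' where "k' = k(i := k i - k l)"
    define J where "J = I - {i, l}"
    have IJ: "I = insert i (insert l J)" and J: "finite J" "i \<notin> J" "l \<notin> J" "i \<notin> insert l J"
      using il assms(2) by (auto simp: J_def)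
    have xc: "x i \<in> carrier G" "x l \<in> carrier G" "x \<in> J \<rightarrow> carrier G"
      using xI il by (auto simp: J_def)
    have x': "x' \<in> I \<rightarrow> carrier G" using xI xc by (auto simp: x'_def Pi_iff)
    define p where "p = finprod G (\<lambda>i. x i [^] k i) J"
    have pc: "p \<in> carrier G" using xc(3) by (auto simp: p_def Pi_iff)
    have prod: "finprod G (\<lambda>i. x i [^] k i) I = x i [^] k i \<otimes> (x l [^] k l \<otimes> p)"
      using xc J by (simp add: IJ p_def Pi_iff)
    have "finprod G (\<lambda>i. x' i [^] k' i) J = p"
      unfolding p_def using xc(3) J by (intro finprod_cong') (auto simp: x'_def k'_def Pi_iff)
    moreover have "finprod G (\<lambda>i. x' i [^] k' i) I
        = x' i [^] k' i \<otimes> (x' l [^] k' l \<otimes> finprod G (\<lambda>i. x' i [^] k' i) J)"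
      using x' J by (simp add: IJ Pi_iff)
    ultimately have "finprod G (\<lambda>i. x' i [^] k' i) I
        = x i [^] (k i - k l) \<otimes> ((x i \<otimes> x l) [^] k l \<otimes> p)"
      using il(3) by (simp add: x'_def k'_def)
    also have "\<dots> = (x i [^] (k i - k l) \<otimes> x i [^] k l) \<otimes> (x l [^] k l \<otimes> p)"
      using xc pc by (simp add: nat_pow_distrib m_assoc)
    also have "\<dots> = x i [^] k i \<otimes> (x l [^] k l \<otimes> p)"
      using xc il(5) by (simp add: nat_pow_mult)
    finally have rel: "finprod G (\<lambda>i. x' i [^] k' i) I = \<one>"
      using prod less.prems(3) by simp
    have sub: "x' ` I \<subseteq> carrier G" using x' by auto
    have in': "x' t \<in> generate G (x' ` I)" if "t \<in> I" for t
      using that by (auto intro: generate.incl)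
    \<comment> \<open>The replacement is invertible, so the new family still generates.\<close>
    have xl: "x l = inv (x' i) \<otimes> x' l"
      using il(3) xc by (simp add: x'_def m_assoc[symmetric])
    have "x l \<in> generate G (x' ` I)" unfolding xl
      using generate.eng[OF generate_m_inv_closed[OF sub in'[OF il(1)]] in'[OF il(2)]] .
    then have "x t \<in> generate G (x' ` I)" if "t \<in> I" for t
      using in'[OF that] by (cases "t = l") (simp_all add: x'_def)
    then have "x ` I \<subseteq> generate G (x' ` I)" by blast
    then have "generate G (x ` I) \<subseteq> generate G (x' ` I)"
      using generate_is_subgroup[OF sub] by (rule generate_subgroup_incl)
    then have gen: "generate G (x' ` I) = carrier G"
      using less.prems(2) generate_incl[OF sub] by auto
    have "sum k' I < sum k I"
      using il by (intro sum_strict_mono_ex1) (auto simp: assms(2) k'_def intro!: bexI[of _ i])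
    moreover have "\<exists>t\<in>I. k' t > 0" using il by (intro bexI[of _ l]) (auto simp: k'_def)
    ultimately show ?thesis using less.hyps[of k' x'] x' gen rel by simp
  qed
qed

text \<open>The exponents count occurrences of each generator in a positive word. Such a word is
  nonempty, so some exponent is positive; this makes the relation nontrivial when \<open>g\<close>
  is the identity.\<close>

lemma (in comm_group) hom_semigroup_generate_eq_finprod:
  assumes "finite X" "f \<in> hom H G" "X \<subseteq> carrier H" "group H" "g \<in> semigroup_generate H X"
  shows "\<exists>k :: 'c \<Rightarrow> nat. (\<exists>x\<in>X. k x > 0) \<and> f g = finprod G (\<lambda>x. f x [^] k x) X"
  using assms(5)
proof induction
  case (incl x)
  have fX: "f y \<in> carrier G" if "y \<in> X" for y
    using that assms(2,3) by (auto simp: hom_def Pi_iff)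
  have X: "X = insert x (X - {x})" using incl by auto
  define k where "k y = (if y = x then 1 else 0 :: nat)" for y
  have "finprod G (\<lambda>y. f y [^] k y) (X - {x}) = \<one>"
    by (intro finprod_one_eqI) (auto simp: k_def)
  moreover have "finprod G (\<lambda>y. f y [^] k y) X
      = f x [^] k x \<otimes> finprod G (\<lambda>y. f y [^] k y) (X - {x})"
    using fX incl assms(1) by (subst X, subst finprod_insert) auto
  ultimately have "f x = finprod G (\<lambda>y. f y [^] k y) X"
    using fX incl by (simp add: k_def)
  moreover have "\<exists>x\<in>X. k x > 0" using incl by (auto simp: k_def)
  ultimately show ?case by blast
next
  case (mult g h)
  have fX: "f y \<in> carrier G" if "y \<in> X" for y
    using that assms(2,3) by (auto simp: hom_def Pi_iff)
  obtain k :: "'c \<Rightarrow> nat" where k: "\<exists>x\<in>X. k x > 0" "f g = finprod G (\<lambda>x. f x [^] k x) X"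
    using mult.IH(1) by blast
  obtain l :: "'c \<Rightarrow> nat" where l: "\<exists>x\<in>X. l x > 0" "f h = finprod G (\<lambda>x. f x [^] l x) X"
    using mult.IH(2) by blast
  have "g \<in> carrier H" "h \<in> carrier H"
    using mult.hyps group.semigroup_generate_subset_generate[OF assms(4)]
      group.generate_incl[OF assms(4,3)] by blast+
  then have "f (g \<otimes>\<^bsub>H\<^esub> h) = f g \<otimes> f h" using assms(2) by (simp add: hom_mult)
  also have "\<dots> = finprod G (\<lambda>x. f x [^] k x \<otimes> f x [^] l x) X"
    unfolding k(2) l(2) using fX by (intro finprod_multf[symmetric]) auto
  also have "\<dots> = finprod G (\<lambda>x. f x [^] (k x + l x)) X"
    using fX by (intro finprod_cong') (auto simp: nat_pow_mult)
  finally show ?case using k(1) by (intro exI[of _ "\<lambda>x. k x + l x"]) auto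
qed

section \<open>Generating a nilpotent group modulo its derived subgroup\<close>

text \<open>Conjugation sends the commutator of \<open>h\<close> and \<open>b\<close> to the
  commutator of their conjugates, so the generating set of each later term is closed under
  conjugation.\<close>

lemma (in group) lower_central_normal: "lower_central G n \<lhd> G"
proof (induction n)
  case 0
  then show ?case by (simp add: normal_self)
next
  case (Suc n)
  interpret N: normal "lower_central G n" G by (rule Suc)
  have mem: "h \<in> carrier G" if "h \<in> lower_central G n" for h using that N.subset by blast
  show ?case unfolding lower_central.simps
  proof (rule normal_generateI)
    fix c g assume "c \<in> (\<Union>h\<in>lower_central G n. \<Union>g\<in>carrier G. {h \<otimes> g \<otimes> inv h \<otimes> inv g})"
      and g: "g \<in> carrier G"
    then obtain h b where hb: "h \<in> lower_central G n" "b \<in> carrier G"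
      "c = h \<otimes> b \<otimes> inv h \<otimes> inv b" by auto
    let ?c = "\<lambda>a. g \<otimes> a \<otimes> inv g"
    have cancel: "inv g \<otimes> (g \<otimes> a) = a" if "a \<in> carrier G" for a
      using that g by (simp add: m_assoc[symmetric])
    have "g \<otimes> c \<otimes> inv g = ?c h \<otimes> ?c b \<otimes> inv (?c h) \<otimes> inv (?c b)"
      using hb mem[OF hb(1)] g by (simp add: inv_mult_group m_assoc cancel)
    moreover have "?c h \<in> lower_central G n" using N.inv_op_closed2[OF g hb(1)] .
    moreover have "?c b \<in> carrier G" using g hb by simp
    ultimately show "g \<otimes> c \<otimes> inv g
        \<in> (\<Union>h\<in>lower_central G n. \<Union>g\<in>carrier G. {h \<otimes> g \<otimes> inv h \<otimes> inv g})"
      by blast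
  qed (use mem in auto)
qed

lemma (in group) commutator_mult_swap:
  assumes "x \<in> carrier G" "y \<in> carrier G"
  shows "x \<otimes> y \<otimes> inv x \<otimes> inv y \<otimes> (y \<otimes> x) = x \<otimes> y"
proof -
  have "inv a \<otimes> (a \<otimes> b) = b" if "a \<in> carrier G" "b \<in> carrier G" for a b
    using that by (simp add: m_assoc[symmetric])
  then show ?thesis using assms by (simp add: m_assoc)
qed

text \<open>Central factors drop out of commutators: for central \<open>u\<close> and
  \<open>v\<close>, the commutator of \<open>u \<otimes> a\<close> and \<open>v \<otimes> b\<close>
  is that of \<open>a\<close> and \<open>b\<close>.\<close>

lemma (in group) derived_subset_of_central_factor:
  assumes K: "subgroup K G"
    and cov: "\<And>x. x \<in> carrier G \<Longrightarrow> \<exists>u\<in>carrier G. \<exists>a\<in>K. x = u \<otimes> a \<and> (\<forall>g\<in>carrier G. u \<otimes> g = g \<otimes> u)"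
  shows "derived G (carrier G) \<subseteq> K"
  unfolding derived_def
proof (intro generate_subgroup_incl[OF _ K] subsetI)
  fix c assume "c \<in> derived_set G (carrier G)"
  then obtain x y where xy: "x \<in> carrier G" "y \<in> carrier G" "c = x \<otimes> y \<otimes> inv x \<otimes> inv y" by auto
  obtain u a where u: "u \<in> carrier G" "a \<in> K" "x = u \<otimes> a" "\<And>g. g \<in> carrier G \<Longrightarrow> u \<otimes> g = g \<otimes> u"
    using cov[OF xy(1)] by blast
  obtain v b where v: "v \<in> carrier G" "b \<in> K" "y = v \<otimes> b" "\<And>g. g \<in> carrier G \<Longrightarrow> v \<otimes> g = g \<otimes> v"
    using cov[OF xy(2)] by blast
  have c: "a \<in> carrier G" "b \<in> carrier G" using u v subgroup.subset[OF K] by auto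
  have u': "u \<otimes> (g \<otimes> h) = g \<otimes> (u \<otimes> h)" if "g \<in> carrier G" "h \<in> carrier G" for g h
    using that u(1) u(4)[OF that(1)] by (simp add: m_assoc[symmetric])
  have v': "v \<otimes> (g \<otimes> h) = g \<otimes> (v \<otimes> h)" if "g \<in> carrier G" "h \<in> carrier G" for g h
    using that v(1) v(4)[OF that(1)] by (simp add: m_assoc[symmetric])
  let ?d = "a \<otimes> b \<otimes> inv a \<otimes> inv b"
  have d: "?d \<in> carrier G" using c by simp
  \<comment> \<open>Both commutators are compared through their product with
    \<open>y \<otimes> x\<close>, which is then cancelled.\<close>
  have "x \<otimes> y = u \<otimes> (v \<otimes> (a \<otimes> b))"
    using u(1,3) v(1,3) c v'[of a b] by (simp add: m_assoc)
  also have "a \<otimes> b = ?d \<otimes> (b \<otimes> a)" using commutator_mult_swap[OF c] by simp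
  also have "u \<otimes> (v \<otimes> (?d \<otimes> (b \<otimes> a))) = ?d \<otimes> (u \<otimes> (v \<otimes> (b \<otimes> a)))"
    using v'[OF d] u'[OF d] u(1) v(1) c by simp
  also have "u \<otimes> (v \<otimes> (b \<otimes> a)) = y \<otimes> x"
    using u(1,3) v(1,3) c u'[of v "b \<otimes> a"] u'[of b a] by (simp add: m_assoc)
  finally have "c \<otimes> (y \<otimes> x) = ?d \<otimes> (y \<otimes> x)"
    using commutator_mult_swap[OF xy(1,2)] xy(3) by simp
  moreover have "c \<in> carrier G" using xy by simp
  ultimately have "c = ?d"
    using d xy(1,2) right_cancel[of "y \<otimes> x" c ?d] by simp
  then show "c \<in> K" using u(2) v(2) K by (simp add: subgroup.m_closed subgroup.m_inv_closed)
qed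

text \<open>By induction on \<open>n\<close>, every element is a product from
  \<open>lower_central G n\<close> and \<open>K\<close>; a trivial term then gives the claim. Modulo
  the next term, \<open>lower_central G n\<close> is central, so the previous lemma puts the derived
  subgroup of the quotient inside the image of \<open>K\<close>. Hence
  \<open>derived G (carrier G)\<close> lies in the next term times \<open>K\<close>, and
  \<open>cov\<close> extends this to the whole group.\<close>

lemma (in group) nilpotent_eq_of_mult_derived:
  assumes nil: "nilpotent_group G" and K: "subgroup K G"
    and cov: "\<And>g. g \<in> carrier G \<Longrightarrow> \<exists>d\<in>derived G (carrier G). \<exists>a\<in>K. g = d \<otimes> a"
  shows "K = carrier G"
proof -
  have Kc: "K \<subseteq> carrier G" using K by (rule subgroup.subset)
  have step: "\<forall>g\<in>carrier G. \<exists>u\<in>lower_central G n. \<exists>a\<in>K. g = u \<otimes> a" for n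
  proof (induction n)
    case 0
    have "g = g \<otimes> \<one>" if "g \<in> carrier G" for g using that by simp
    then show ?case using subgroup.one_closed[OF K] by fastforce
  next
    case (Suc n)
    let ?L = "lower_central G n"
    define Z where "Z = lower_central G (Suc n)"
    interpret Z: normal Z G unfolding Z_def by (rule lower_central_normal)
    have Lc: "?L \<subseteq> carrier G"
      using lower_central_normal[of n] by (meson normal_imp_subgroup subgroup.subset)
    \<comment> \<open>Centrality modulo \<open>Z\<close>: the commutator of \<open>u\<close> and
      \<open>g\<close> is one of the generators of \<open>Z\<close>.\<close>
    have comm: "(Z #> u) <#> (Z #> g) = (Z #> g) <#> (Z #> u)"
      if "u \<in> ?L" "g \<in> carrier G" for u g
    proof -
      have uc: "u \<in> carrier G" using that Lc by blast
      have "u \<otimes> g \<otimes> inv u \<otimes> inv g \<in> Z"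
        unfolding Z_def lower_central.simps using that by (intro generate.incl) auto
      moreover have "u \<otimes> g \<otimes> inv u \<otimes> inv g \<otimes> (g \<otimes> u) = u \<otimes> g"
        using commutator_mult_swap[OF uc that(2)] .
      ultimately have "u \<otimes> g \<in> Z #> (g \<otimes> u)" unfolding r_coset_def by force
      then have "Z #> (u \<otimes> g) = Z #> (g \<otimes> u)"
        using repr_independence[OF _ _ Z.subgroup_axioms, of "u \<otimes> g" "g \<otimes> u"] uc that by simp
      then show ?thesis using uc that by (simp add: Z.rcos_sum)
    qed
    interpret Q: group "G Mod Z" by (rule Z.factorgroup_is_group)
    interpret \<pi>: group_hom G "G Mod Z" "\<lambda>g. Z #> g"
      by unfold_locales (rule Z.r_coset_hom_Mod)
    have img: "(\<lambda>g. Z #> g) ` carrier G = carrier (G Mod Z)"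
      by (simp add: carrier_FactGroup)
    have "derived (G Mod Z) (carrier (G Mod Z)) \<subseteq> (\<lambda>g. Z #> g) ` K"
    proof (rule Q.derived_subset_of_central_factor)
      show "subgroup ((\<lambda>g. Z #> g) ` K) (G Mod Z)"
        using K by (rule \<pi>.subgroup_img_is_subgroup)
      fix x assume "x \<in> carrier (G Mod Z)"
      then obtain g where g: "g \<in> carrier G" "x = Z #> g" using img by blast
      then obtain u a where ua: "u \<in> ?L" "a \<in> K" "g = u \<otimes> a" using Suc by blast
      have "x = (Z #> u) \<otimes>\<^bsub>G Mod Z\<^esub> (Z #> a)"
        unfolding g(2) ua(3) using ua Lc Kc by (intro \<pi>.hom_mult) auto
      moreover have "\<forall>y\<in>carrier (G Mod Z).
          (Z #> u) \<otimes>\<^bsub>G Mod Z\<^esub> y = y \<otimes>\<^bsub>G Mod Z\<^esub> (Z #> u)"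
        unfolding img[symmetric] mult_FactGroup using comm[OF ua(1)] by blast
      moreover have "Z #> u \<in> carrier (G Mod Z)" using ua(1) Lc img by blast
      ultimately show "\<exists>u\<in>carrier (G Mod Z). \<exists>a\<in>(\<lambda>g. Z #> g) ` K.
          x = u \<otimes>\<^bsub>G Mod Z\<^esub> a \<and> (\<forall>g\<in>carrier (G Mod Z). u \<otimes>\<^bsub>G Mod Z\<^esub> g = g \<otimes>\<^bsub>G Mod Z\<^esub> u)"
        using ua(2) by blast
    qed
    then have der: "(\<lambda>g. Z #> g) ` derived G (carrier G) \<subseteq> (\<lambda>g. Z #> g) ` K"
      using \<pi>.derived_img[of "carrier G"] img by simp
    show ?case unfolding Z_def[symmetric]
    proof
      fix g assume "g \<in> carrier G"
      then obtain d a where da: "d \<in> derived G (carrier G)" "a \<in> K" "g = d \<otimes> a" using cov by blast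
      obtain b where b: "b \<in> K" "Z #> d = Z #> b" using der da(1) by blast
      have dc: "d \<in> carrier G" using da(1) derived_in_carrier[of "carrier G"] by auto
      \<comment> \<open>Pulling back from the quotient: \<open>d\<close> differs from an element of
        \<open>K\<close> by a left factor in \<open>Z\<close>, and the rest of \<open>g\<close> is
        absorbed into \<open>K\<close>.\<close>
      have "d \<in> Z #> b" using rcos_self[OF dc Z.subgroup_axioms] b(2) by simp
      then obtain z where z: "z \<in> Z" "d = z \<otimes> b" unfolding r_coset_def by blast
      have "g = z \<otimes> (b \<otimes> a)"
        unfolding da(3) z(2) using z(1) Z.subset b(1) da(2) Kc by (intro m_assoc) auto
      moreover have "b \<otimes> a \<in> K" using K b(1) da(2) by (rule subgroup.m_closed)
      ultimately show "\<exists>u\<in>Z. \<exists>a\<in>K. g = u \<otimes> a" using z(1) by blast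
    qed
  qed
  obtain c where "lower_central G c = {\<one>}" using nil unfolding nilpotent_group_def by blast
  then have "\<forall>g\<in>carrier G. \<exists>a\<in>K. g = \<one> \<otimes> a" using step[of c] by simp
  then show ?thesis using Kc by (metis l_one subsetD subsetI subset_antisym)
qed

lemma (in group) nilpotent_generate_lift:
  assumes nil: "nilpotent_group G" and fin: "finite Y"
    and Yc: "Y \<subseteq> carrier (G Mod derived G (carrier G))"
    and gen: "generate (G Mod derived G (carrier G)) Y = carrier (G Mod derived G (carrier G))"
  shows "\<exists>X. finite X \<and> X \<subseteq> carrier G \<and> generate G X = carrier G \<and> card X \<le> card Y"
proof -
  let ?D = "derived G (carrier G)"
  interpret D: normal ?D G by (rule derived_self_is_normal)
  interpret Q: group "G Mod ?D" by (rule D.factorgroup_is_group)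
  interpret \<pi>: group_hom G "G Mod ?D" "\<lambda>g. ?D #> g"
    by unfold_locales (rule D.r_coset_hom_Mod)
  \<comment> \<open>One representative per coset in \<open>Y\<close>, so that the lift has the same
    cardinality.\<close>
  obtain X where X: "X \<subseteq> carrier G" "inj_on (\<lambda>g. ?D #> g) X" "Y = (\<lambda>g. ?D #> g) ` X"
    using Yc unfolding carrier_FactGroup subset_image_inj by blast
  then have "finite X" "card X = card Y" using fin by (simp_all add: finite_image_iff card_image)
  have img: "(\<lambda>g. ?D #> g) ` generate G X = (\<lambda>g. ?D #> g) ` carrier G"
    using gen \<pi>.generate_img[OF X(1)] by (simp add: X(3) carrier_FactGroup)
  have "generate G X = carrier G"
  proof (rule nilpotent_eq_of_mult_derived[OF nil generate_is_subgroup[OF X(1)]])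
    fix g assume g: "g \<in> carrier G"
    then obtain a where a: "a \<in> generate G X" "?D #> g = ?D #> a" using img by blast
    then have "g \<in> ?D #> a" using rcos_self[OF g D.subgroup_axioms] by simp
    then show "\<exists>d\<in>?D. \<exists>a\<in>generate G X. g = d \<otimes> a" using a(1) unfolding r_coset_def by blast
  qed
  then show ?thesis using X(1) \<open>finite X\<close> \<open>card X = card Y\<close> by auto
qed

section \<open>Comparison of the ranks\<close>

lemma group_rank_le:
  assumes "finite X" "X \<subseteq> carrier G" "generate G X = carrier G"
  shows "group_rank G \<le> card X"
  unfolding group_rank_def using assms by (intro Least_le) blast

lemma semigroup_rank_le:
  assumes "finite X" "X \<subseteq> carrier G" "semigroup_generate G X = carrier G"
  shows "semigroup_rank G \<le> card X"
  unfolding semigroup_rank_def using assms by (intro Least_le) blast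

lemma (in group) ex_semigroup_generating_card_le:
  assumes "finite X" "X \<subseteq> carrier G" "generate G X = carrier G"
  shows "\<exists>Y. finite Y \<and> Y \<subseteq> carrier G \<and> semigroup_generate G Y = carrier G \<and> card Y \<le> card X + 1"
proof -
  obtain y where y: "y \<in> carrier G"
    "generate G (insert y X) \<subseteq> semigroup_generate G (insert y X)"
    using ex_generate_subset_semigroup_generate_insert[OF assms(1,2)] by blast
  have "insert y X \<subseteq> carrier G" using y assms(2) by blast
  then have "generate G (insert y X) = carrier G"
    using assms(3) mono_generate[of X "insert y X"] generate_incl[of "insert y X"] by auto
  then have "semigroup_generate G (insert y X) = carrier G"
    using y(2) semigroup_generate_subset_generate[of "insert y X"] by simp
  \<comment> \<open>Only an upper bound on the cardinality results, since \<open>y\<close> may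
    already lie in \<open>X\<close>.\<close>
  then show ?thesis
    using y(1) assms(1,2) by (intro exI[of _ "insert y X"]) (simp add: card_insert_if)
qed

lemma (in group) group_rank_less_card_semigroup_generating:
  assumes nil: "nilpotent_group G"
    and tf: "torsion_free_group (G Mod derived G (carrier G))"
    and X: "finite X" "X \<subseteq> carrier G" "semigroup_generate G X = carrier G"
  shows "group_rank G < card X"
proof -
  let ?D = "derived G (carrier G)"
  interpret D: normal ?D G by (rule derived_self_is_normal)
  interpret Q: comm_group "G Mod ?D" by (rule derived_quot_is_comm_group)
  interpret \<pi>: group_hom G "G Mod ?D" "\<lambda>g. ?D #> g"
    by unfold_locales (rule D.r_coset_hom_Mod)
  have genX: "generate G X = carrier G"
    using X(3) generate_incl[OF X(2)] semigroup_generate_subset_generate[of X] by simp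
  \<comment> \<open>The identity, written as a positive word in \<open>X\<close> and projected to
    the abelianization, yields the relation to be reduced.\<close>
  obtain k :: "'a \<Rightarrow> nat" where k: "\<exists>x\<in>X. k x > 0"
    "?D #> \<one> = finprod (G Mod ?D) (\<lambda>x. (?D #> x) [^]\<^bsub>G Mod ?D\<^esub> k x) X"
    using Q.hom_semigroup_generate_eq_finprod[OF X(1) \<pi>.homh X(2) is_group, of \<one>] X(3) by auto
  have "\<exists>Y. finite Y \<and> Y \<subseteq> carrier (G Mod ?D)
      \<and> generate (G Mod ?D) Y = carrier (G Mod ?D) \<and> card Y < card X"
  \<comment> \<open>The family is the projection indexed by \<open>X\<close> itself; it may identify
    elements, but the bound is against \<open>card X\<close>.\<close>
  proof (rule Q.generate_drop_of_relation[OF tf X(1) _ _ _ k(1)])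
    show "(\<lambda>x. ?D #> x) \<in> X \<rightarrow> carrier (G Mod ?D)" using X(2) by auto
    show "generate (G Mod ?D) ((\<lambda>x. ?D #> x) ` X) = carrier (G Mod ?D)"
      using \<pi>.generate_img[OF X(2)] by (simp add: genX carrier_FactGroup)
    show "finprod (G Mod ?D) (\<lambda>x. (?D #> x) [^]\<^bsub>G Mod ?D\<^esub> k x) X = \<one>\<^bsub>G Mod ?D\<^esub>"
      using k(2) \<pi>.hom_one by simp
  qed
  then obtain Y where Y: "finite Y" "Y \<subseteq> carrier (G Mod ?D)"
    "generate (G Mod ?D) Y = carrier (G Mod ?D)" "card Y < card X" by blast
  then obtain Z where "finite Z" "Z \<subseteq> carrier G" "generate G Z = carrier G" "card Z \<le> card Y"
    using nilpotent_generate_lift[OF nil Y(1-3)] by blast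
  then show ?thesis using group_rank_le[of Z G] Y(4) by linarith
qed

theorem corollary4p5:
  fixes G :: "('a, 'b) monoid_scheme"
  assumes "group G"
    and "finitely_generated_group G"
    and "nilpotent_group G"
    and "torsion_free_group (G Mod (derived G (carrier G)))"
  shows "semigroup_rank G = group_rank G + 1"
proof -
  interpret group G by (rule assms(1))
  \<comment> \<open>Finite generation ensures that the \<open>LEAST\<close> in
    \<open>group_rank\<close> is attained.\<close>
  have "\<exists>n X. finite X \<and> X \<subseteq> carrier G \<and> generate G X = carrier G \<and> card X = n"
    using assms(2) unfolding finitely_generated_group_def by blast
  then have "\<exists>X. finite X \<and> X \<subseteq> carrier G \<and> generate G X = carrier G \<and> card X = group_rank G"
    unfolding group_rank_def by (rule LeastI_ex)
  then obtain Y where Y: "finite Y" "Y \<subseteq> carrier G" "semigroup_generate G Y = carrier G"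
    "card Y \<le> group_rank G + 1"
    using ex_semigroup_generating_card_le by metis
  \<comment> \<open>The set \<open>Y\<close> from the upper bound also shows that the
    \<open>LEAST\<close> in \<open>semigroup_rank\<close> is attained, so the lower bound applies to
    a minimal set.\<close>
  then have "\<exists>n X. finite X \<and> X \<subseteq> carrier G \<and> semigroup_generate G X = carrier G \<and> card X = n"
    by blast
  then have "\<exists>X. finite X \<and> X \<subseteq> carrier G \<and> semigroup_generate G X = carrier G
      \<and> card X = semigroup_rank G"
    unfolding semigroup_rank_def by (rule LeastI_ex)
  then have "group_rank G < semigroup_rank G"
    using group_rank_less_card_semigroup_generating[OF assms(3,4)] by metis
  moreover have "semigroup_rank G \<le> group_rank G + 1"
    using semigroup_rank_le[OF Y(1-3)] Y(4) by linarith
  ultimately show ?thesis by linarith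
qed

end
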